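(* Let $\{X_i\}_{i\ge 1}$ be a stationary, reversible Markov chain on $(\mathcal X,\mathcal B)$ with invariant distribution $\pi$ (so $X_1\sim\pi$) and right spectral gap $1-\lambda_r>0$, where $\lambda_r=\lambda_r(P)$. Let $c>0$ and let $f:\mathcal X\to\mathbb R$ be a measurable function with $|f|\le c$ and $\pi(f)=0$. Put $\sigma^2=\pi(f^2)$. Then for every $n\ge1$ and any $0\le t<(1-\max\{\lambda_r,0\})/(5c)$, $$\mathbb E_\pi\left[e^{t\sum_{i=1}^n f(X_i)}\right]\le e^{n g(t;\max\{\lambda_r,0\},c,\sigma^2)}.$$ Moreover, for any $\epsilon>0$, $$\mathbb P_\pi\left(\frac1n\sum_{i=1}^n f(X_i)\ge\epsilon\right)\le e^{-n g^*(\epsilon;\max\{\lambda_r,0\},c,\sigma^2)}.$$ Here $g$ and $g^*$ are the functions defined in the context.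
   Context: $(\mathcal X,\mathcal B)$ is a standard Borel space and the Markov chain is time-homogeneous with transition kernel $P(x,B)$ that leaves the probability measure $\pi$ invariant. For measurable $h:\mathcal X\to\mathbb R$ write $\pi(h)=\int h\,d\pi$. $\mathcal L_2=\{h:\pi(h^2)<\infty\}$ is the real Hilbert space with inner product $\langle h_1,h_2\rangle_\pi=\pi(h_1h_2)$ and norm $\|h\|_\pi$, and $\mathcal L_2^0=\{h\in\mathcal L_2:\pi(h)=0\}$. The kernel acts on $\mathcal L_2$ by $Ph(x)=\int h(y)P(x,dy)$; reversible means $P$ is self-adjoint on $\mathcal L_2$. The chain has right spectral gap $1-\lambda_r(P)>0$ if $$\lambda_r(P)=\sup\{\langle h,Ph\rangle_\pi:\|h\|_\pi=1,\ h\in\mathcal L_2^0\}<1.$$ $\mathbb E_\pi,\mathbb P_\pi$ denote expectation and probability for the chain started from $X_1\sim\pi$. For $\lambda\in[0,1)$, $c>0$, $\sigma^2\ge0$ and $0\le t<(1-\lambda)/(5c)$ define $$g(t;\lambda,c,\sigma^2)=\frac{\sigma^2}{c^2}\left(e^{tc}-1-tc\right)+\frac{\sigma^2\lambda t^2}{1-\lambda-5ct},$$ and let $g^*$ be its convex conjugate: for $\lambda\in(0,1)$, $g^*(\epsilon;\lambda,c,\sigma^2)=\sup\{t\epsilon-g(t;\lambda,c,\sigma^2):0\le t<(1-\lambda)/(5c)\}$. For $\lambda=0$ the second summand of $g$ is identically $0$, so $g(t;0,c,\sigma^2)=\frac{\sigma^2}{c^2}(e^{tc}-1-tc)$, and $g^*(\epsilon;0,c,\sigma^2)=\sup\{t\epsilon-g(t;0,c,\sigma^2):t\ge0\}$.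 *)

theory Defs
  imports "HOL-Probability.Probability"
begin

definition standard_borel :: "'a measure \<Rightarrow> bool" where
  "standard_borel M \<longleftrightarrow>
     (\<exists>T. topspace T = space M \<and> completely_metrizable_space T \<and> separable_space T \<and>
          sets M = sigma_sets (space M) {U. openin T U})"

text \<open>A Markov kernel on \<open>M\<close> is a map \<open>P \<in> M \<rightarrow>\<^sub>M prob_algebra M\<close>,
  with \<open>P(x, B) = measure (P x) B\<close>.\<close>

definition invariant_measure :: "('a \<Rightarrow> 'a measure) \<Rightarrow> 'a measure \<Rightarrow> bool" where
  "invariant_measure P \<pi> \<longleftrightarrow>
     (\<forall>B \<in> sets \<pi>. (\<integral>\<^sup>+ x. emeasure (P x) B \<partial>\<pi>) = emeasure \<pi> B)"

definition kernel_op :: "('a \<Rightarrow> 'a measure) \<Rightarrow> ('a \<Rightarrow> real) \<Rightarrow> 'a \<Rightarrow> real" where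
  "kernel_op P h x = (\<integral> y. h y \<partial>P x)"

text \<open>Elements of \<open>L2 \<pi>\<close> are functions rather than classes modulo \<open>\<pi>\<close>-null sets. For invariant
  \<open>\<pi>\<close> the operator \<open>kernel_op P\<close> respects these classes; at the \<open>\<pi>\<close>-null set of
  points \<open>x\<close> where \<open>h \<in> L2 \<pi>\<close> is not integrable for \<open>P x\<close> it takes the irrelevant value 0.\<close>

definition L2 :: "'a measure \<Rightarrow> ('a \<Rightarrow> real) set" where
  "L2 \<pi> = {h \<in> borel_measurable \<pi>. integrable \<pi> (\<lambda>x. (h x)\<^sup>2)}"

definition L2_zero :: "'a measure \<Rightarrow> ('a \<Rightarrow> real) set" where
  "L2_zero \<pi> = {h \<in> L2 \<pi>. (\<integral> x. h x \<partial>\<pi>) = 0}"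

definition inner_L2 :: "'a measure \<Rightarrow> ('a \<Rightarrow> real) \<Rightarrow> ('a \<Rightarrow> real) \<Rightarrow> real" where
  "inner_L2 \<pi> h1 h2 = (\<integral> x. h1 x * h2 x \<partial>\<pi>)"

definition norm_L2 :: "'a measure \<Rightarrow> ('a \<Rightarrow> real) \<Rightarrow> real" where
  "norm_L2 \<pi> h = sqrt (inner_L2 \<pi> h h)"

definition reversible_kernel :: "('a \<Rightarrow> 'a measure) \<Rightarrow> 'a measure \<Rightarrow> bool" where
  "reversible_kernel P \<pi> \<longleftrightarrow>
     (\<forall>h1 \<in> L2 \<pi>. \<forall>h2 \<in> L2 \<pi>.
        inner_L2 \<pi> (kernel_op P h1) h2 = inner_L2 \<pi> h1 (kernel_op P h2))"

text \<open>The supremum is taken in the extended reals: it is \<open>-\<infinity>\<close> when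
  \<open>L2_zero \<pi>\<close> contains only null functions (for instance if \<open>\<pi>\<close> is a point mass).\<close>

definition lambda_r :: "('a \<Rightarrow> 'a measure) \<Rightarrow> 'a measure \<Rightarrow> ereal" where
  "lambda_r P \<pi> =
     (SUP h \<in> {h \<in> L2_zero \<pi>. norm_L2 \<pi> h = 1}. ereal (inner_L2 \<pi> h (kernel_op P h)))"

text \<open>\<open>max {lambda_r, 0}\<close> as a real number; the conversion is lossless if \<open>lambda_r P \<pi> < 1\<close>.\<close>

definition lambda_r_plus :: "('a \<Rightarrow> 'a measure) \<Rightarrow> 'a measure \<Rightarrow> real" where
  "lambda_r_plus P \<pi> = real_of_ereal (max (lambda_r P \<pi>) 0)"

text \<open>The sigma-algebra generated by \<open>X 1, \<dots>, X n\<close>; chains are indexed from 1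
  and the value \<open>X 0\<close> is never used.\<close>

definition history :: "'w measure \<Rightarrow> 'a measure \<Rightarrow> (nat \<Rightarrow> 'w \<Rightarrow> 'a) \<Rightarrow> nat \<Rightarrow> 'w measure" where
  "history \<Omega> M X n =
     sigma (space \<Omega>) (\<Union>i\<in>{1..n}. {X i -` B \<inter> space \<Omega> | B. B \<in> sets M})"

definition markov_chain ::
  "'w measure \<Rightarrow> 'a measure \<Rightarrow> ('a \<Rightarrow> 'a measure) \<Rightarrow> (nat \<Rightarrow> 'w \<Rightarrow> 'a) \<Rightarrow> bool" where
  "markov_chain \<Omega> M P X \<longleftrightarrow>
     (\<forall>i\<ge>1. X i \<in> \<Omega> \<rightarrow>\<^sub>M M) \<and>
     (\<forall>n\<ge>1. \<forall>B \<in> sets M.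
        AE \<omega> in \<Omega>.
          real_cond_exp \<Omega> (history \<Omega> M X n) (indicator (X (Suc n) -` B \<inter> space \<Omega>)) \<omega>
          = measure (P (X n \<omega>)) B)"

text \<open>For \<open>lam = 0\<close> the second summand of \<open>g\<close> is 0 for every \<open>t\<close>, since \<open>0 / x = 0\<close>
  also for \<open>x = 0\<close>.\<close>

definition g :: "real \<Rightarrow> real \<Rightarrow> real \<Rightarrow> real \<Rightarrow> real" where
  "g t lam c \<sigma>2 =
     \<sigma>2 / c\<^sup>2 * (exp (t * c) - 1 - t * c) + \<sigma>2 * lam * t\<^sup>2 / (1 - lam - 5 * c * t)"

text \<open>The conjugate is extended-real valued: it is \<open>\<infinity>\<close> if \<open>lam = 0\<close>, \<open>\<sigma>2 = 0\<close>
  and \<open>\<epsilon> > 0\<close>.\<close>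

definition g_conj :: "real \<Rightarrow> real \<Rightarrow> real \<Rightarrow> real \<Rightarrow> ereal" where
  "g_conj \<epsilon> lam c \<sigma>2 =
     (SUP t \<in> (if lam = 0 then {0..} else {0..<(1 - lam) / (5 * c)}).
        ereal (t * \<epsilon> - g t lam c \<sigma>2))"

definition exp_ereal :: "ereal \<Rightarrow> ereal" where
  "exp_ereal x = (case x of ereal r \<Rightarrow> ereal (exp r) | PInfty \<Rightarrow> \<infinity> | MInfty \<Rightarrow> 0)"

end

theory Submission
  imports Defs
begin

text \<open>With \<open>F = exp (t * f)\<close> and \<open>T h = P (F * h)\<close>, the Markov property turns the moment generating
  function into \<open>\<integral>F * T^(n-1) 1 d\<pi>\<close>. The operator \<open>T\<close> is symmetric for the weight \<open>F d\<pi>\<close> and preserves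
  positivity, so a one-sided bound \<open>r\<close> on its quadratic form bounds its norm. For \<open>u = F * h\<close> the
  spectral gap bounds this form by \<open>(1 - lam) * \<pi>(u)^2 + lam * \<pi>(u^2)\<close>, and by Cauchy-Schwarz this is at
  most \<open>r * \<pi>(u^2 / F)\<close> as soon as \<open>\<pi>((1 - lam) / (r / F - lam)) \<le> 1\<close>. For \<open>r = exp (g t)\<close> the latter
  follows from a pointwise bound of the integrand by a quadratic polynomial in \<open>f\<close>.\<close>

section \<open>Scalar inequalities\<close>

text \<open>The power series are compared term by term from order two on, where
  \<open>\<bar>z\<bar> \<le> 1\<close> lets two factors of \<open>z\<close> be kept and the rest be
  bounded by 1. With \<open>z = f x / c\<close> and \<open>b = t * c\<close> this is the pointwise
  bound behind Bennett's inequality.\<close>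

lemma exp_mult_quadratic_bound:
  fixes z b :: real
  assumes "\<bar>z\<bar> \<le> 1" "0 \<le> b"
  shows "exp (z * b) \<le> 1 + z * b + z\<^sup>2 * (exp b - 1 - b)"
proof -
  have split: "(\<lambda>n. y ^ (n + 2) /\<^sub>R fact (n + 2)) sums (exp y - 1 - y)" for y :: real
  proof -
    have "(\<lambda>n. y ^ (n + 2) /\<^sub>R fact (n + 2)) sums (exp y - (\<Sum>i<2. y ^ i /\<^sub>R fact i))"
      using exp_converges[of y] by (rule sums_split_initial_segment)
    thus ?thesis by (simp add: numeral_2_eq_2 algebra_simps)
  qed
  have term_le: "(z * b) ^ (n + 2) /\<^sub>R fact (n + 2) \<le> z\<^sup>2 * (b ^ (n + 2) /\<^sub>R fact (n + 2))" for n
  proof -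
    have "z ^ n \<le> 1"
      using assms(1) by (metis abs_ge_self abs_ge_zero order_trans power_abs power_le_one)
    hence "z ^ n * (z\<^sup>2 * b ^ (n + 2)) \<le> 1 * (z\<^sup>2 * b ^ (n + 2))"
      using assms(2) by (intro mult_right_mono) auto
    hence "(z * b) ^ (n + 2) \<le> z\<^sup>2 * b ^ (n + 2)"
      by (simp add: power_mult_distrib power_add power2_eq_square ac_simps)
    thus ?thesis by (simp add: divide_simps)
  qed
  have "exp (z * b) - 1 - z * b \<le> z\<^sup>2 * (exp b - 1 - b)"
    by (rule sums_le[OF term_le split sums_mult[OF split]])
  thus ?thesis by simp
qed

text \<open>For \<open>x \<le> 0\<close> the bounds
  \<open>\<bar>exp x - 1\<bar> \<le> \<bar>x\<bar>\<close> and \<open>lam * exp x \<le> lam\<close>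
  suffice. For \<open>x > 0\<close>, where \<open>b \<le> 1/5\<close>, the losses relative to
  \<open>1 - lam\<close> are at most \<open>11/5 * b\<close> from the factor
  \<open>(1 + b)^2\<close> and \<open>6/5 * b\<close> from \<open>lam * exp x\<close>; the constant
  5 covers both.\<close>

lemma square_exp_minus_one_bound:
  fixes lam x b :: real
  assumes "0 \<le> lam" "lam < 1" "\<bar>x\<bar> \<le> b" "5 * b < 1 - lam"
  shows "(exp x - 1)\<^sup>2 * (1 - lam - 5 * b) \<le> x\<^sup>2 * (1 - lam * exp x)"
    and "lam * exp x < 1"
proof -
  have b: "0 \<le> b" "b \<le> 1/5" using assms by auto
  have "(exp x - 1)\<^sup>2 * (1 - lam - 5 * b) \<le> x\<^sup>2 * (1 - lam * exp x) \<and> lam * exp x < 1"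
  proof (cases "x \<le> 0")
    case True
    have e: "exp x \<le> 1" "1 + x \<le> exp x" using True by (auto simp: exp_ge_add_one_self)
    have le: "lam * exp x \<le> lam" using e assms(1) by (simp add: mult_left_le)
    have "\<bar>exp x - 1\<bar> \<le> \<bar>x\<bar>" using e True by linarith
    hence sq: "(exp x - 1)\<^sup>2 \<le> x\<^sup>2" by (rule abs_le_square_iff[THEN iffD1])
    have "(exp x - 1)\<^sup>2 * (1 - lam - 5 * b) \<le> x\<^sup>2 * (1 - lam * exp x)"
      using sq le b assms by (intro mult_mono) auto
    thus ?thesis using le assms by linarith
  next
    case False
    hence x: "0 < x" "x \<le> b" using assms by auto
    have "exp x \<le> 1 + x + x\<^sup>2" using x b by (intro exp_bound) auto
    moreover have "x * (1 + x) \<le> x * (1 + b)" using x by (intro mult_left_mono) auto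
    ultimately have e: "exp x - 1 \<le> x * (1 + b)" by (simp add: algebra_simps power2_eq_square)
    have pos: "0 \<le> exp x - 1" using x by simp
    have "(exp x - 1)\<^sup>2 \<le> (x * (1 + b))\<^sup>2" using e pos by (rule power_mono)
    hence "(exp x - 1)\<^sup>2 * (1 - lam - 5 * b) \<le> (x * (1 + b))\<^sup>2 * (1 - lam - 5 * b)"
      using assms by (intro mult_right_mono) auto
    also have "\<dots> = x\<^sup>2 * ((1 + b)\<^sup>2 * (1 - lam - 5 * b))" by (simp add: power_mult_distrib)
    also have "\<dots> \<le> x\<^sup>2 * (1 - lam * exp x)"
    proof (intro mult_left_mono)
      have "x * (1 + b) \<le> b * (6/5)" using x b by (intro mult_mono) auto
      hence "exp x - 1 \<le> 6/5 * b" using e by simp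
      moreover have "lam * (exp x - 1) \<le> exp x - 1"
        using pos assms by (intro mult_left_le_one_le) auto
      ultimately have l: "1 - lam - 6/5 * b \<le> 1 - lam * exp x" by (simp add: algebra_simps)
      have "b * b \<le> b * (1/5)" using b by (intro mult_left_mono) auto
      hence "(1 + b)\<^sup>2 \<le> 1 + 11/5 * b" by (simp add: power2_eq_square algebra_simps)
      hence "(1 + b)\<^sup>2 * (1 - lam - 5 * b) \<le> (1 + 11/5 * b) * (1 - lam - 5 * b)"
        using assms by (intro mult_right_mono) auto
      also have "\<dots> = 1 - lam - 5 * b + 11/5 * (b * (1 - lam - 5 * b))"
        by (simp only: distrib_right mult_1 mult.assoc)
      also have "\<dots> \<le> 1 - lam - 5 * b + 11/5 * (b * 1)"
        using b assms by (intro add_left_mono mult_left_mono) auto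
      also have "\<dots> \<le> 1 - lam - 6/5 * b" using b by simp
      finally show "(1 + b)\<^sup>2 * (1 - lam - 5 * b) \<le> 1 - lam * exp x" using l by linarith
    qed simp
    finally have main: "(exp x - 1)\<^sup>2 * (1 - lam - 5 * b) \<le> x\<^sup>2 * (1 - lam * exp x)" .
    \<comment> \<open>The second claim is read off the first: a strictly positive left-hand side
      forces \<open>1 - lam * exp x\<close> to be positive.\<close>
    moreover have "0 < (exp x - 1)\<^sup>2 * (1 - lam - 5 * b)" using x assms by simp
    ultimately have "0 < x\<^sup>2 * (1 - lam * exp x)" by linarith
    thus ?thesis using main x by (simp add: zero_less_mult_iff)
  qed
  thus "(exp x - 1)\<^sup>2 * (1 - lam - 5 * b) \<le> x\<^sup>2 * (1 - lam * exp x)" "lam * exp x < 1"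
    by auto
qed

text \<open>The majorant is quadratic in \<open>x\<close>, so only the first two moments enter after integration. The
  part \<open>(exp x - 1) / (r - lam * exp x)\<close> of the left-hand side is convex in \<open>x\<close> and enters with a
  negative sign, so it may be replaced by its tangent at \<open>0\<close>.\<close>

lemma resolvent_quadratic_bound:
  fixes lam x b r S :: real
  assumes lam: "0 \<le> lam" "lam < 1" and x: "\<bar>x\<bar> \<le> b" and b: "lam = 0 \<or> 5 * b < 1 - lam"
    and r: "1 \<le> r" and S: "exp x \<le> 1 + x + S"
  shows "lam < r * exp (- x)"
    and "(1 - lam) / (r * exp (- x) - lam)
      \<le> 1 + (1 - r + (1 - lam * (r - 1) / (r - lam)) * x + (S + lam * x\<^sup>2 / (1 - lam - 5 * b))) / (r - lam)"
proof -
  have lt1: "lam * exp x < 1"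
    using b square_exp_minus_one_bound(2)[OF lam x] by auto
  hence D: "0 < r - lam * exp x" and Dr: "1 - lam * exp x \<le> r - lam * exp x" using r by auto
  have rl: "0 < r - lam" using r lam by auto
  have "lam * exp x * exp (- x) < r * exp (- x)" using D by (intro mult_strict_right_mono) auto
  thus "lam < r * exp (- x)" by (simp add: mult.assoc flip: exp_add)
  have w: "(1 - lam) / (r * exp (- x) - lam) = 1 + (exp x - r) / (r - lam * exp x)"
  proof -
    have "r * exp (- x) - lam = (r - lam * exp x) / exp x"
      by (simp add: exp_minus divide_simps)
    hence "(1 - lam) / (r * exp (- x) - lam) = (1 - lam) * exp x / (r - lam * exp x)" by simp
    also have "\<dots> = 1 + (exp x - r) / (r - lam * exp x)"
      using D by (simp add: divide_simps) (simp add: algebra_simps)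
    finally show ?thesis .
  qed
  \<comment> \<open>Write \<open>r - lam = (r - lam * exp x) + lam * (exp x - 1)\<close>, expand,
    and split \<open>exp x - r = (exp x - 1) - (r - 1)\<close> in the term that keeps the
    denominator.\<close>
  have decomp: "(r - lam) * ((exp x - r) / (r - lam * exp x))
      = (exp x - r) + lam * (exp x - 1)\<^sup>2 / (r - lam * exp x)
        - lam * (r - 1) * ((exp x - 1) / (r - lam * exp x))"
    using D by (simp add: divide_simps) (simp add: algebra_simps power2_eq_square)
  have quad: "lam * (exp x - 1)\<^sup>2 / (r - lam * exp x) \<le> lam * x\<^sup>2 / (1 - lam - 5 * b)"
  \<comment> \<open>For \<open>lam = 0\<close> both sides vanish whatever the sign of
    \<open>1 - lam - 5 * b\<close>, which is why \<open>b\<close> may then be arbitrarily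
    large.\<close>
  proof (cases "lam = 0")
    case False
    hence b': "5 * b < 1 - lam" using b by auto
    have "(exp x - 1)\<^sup>2 * (1 - lam - 5 * b) \<le> x\<^sup>2 * (1 - lam * exp x)"
      by (rule square_exp_minus_one_bound(1)[OF lam x b'])
    also have "\<dots> \<le> x\<^sup>2 * (r - lam * exp x)" using Dr by (intro mult_left_mono) auto
    finally have "(exp x - 1)\<^sup>2 / (r - lam * exp x) \<le> x\<^sup>2 / (1 - lam - 5 * b)"
      using D b' by (simp add: divide_simps)
    from mult_left_mono[OF this lam(1)] show ?thesis by simp
  qed simp
  \<comment> \<open>For \<open>x \<ge> 0\<close> the right-hand quotient has the larger numerator
    and the smaller denominator. For \<open>x < 0\<close> both quotients are nonpositive, and the
    same comparison is made for their negatives.\<close>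
  have tangent: "x / (r - lam) \<le> (exp x - 1) / (r - lam * exp x)"
  proof (cases "0 \<le> x")
    case True
    have "lam * 1 \<le> lam * exp x" using True lam by (intro mult_left_mono) auto
    moreover have "x \<le> exp x - 1" using exp_ge_add_one_self[of x] by linarith
    ultimately show ?thesis using True D by (intro frac_le) auto
  next
    case False
    have "lam * exp x \<le> lam * 1" using False lam by (intro mult_left_mono) auto
    moreover have "1 - exp x \<le> - x" using exp_ge_add_one_self[of x] by linarith
    ultimately have "(1 - exp x) / (r - lam * exp x) \<le> (- x) / (r - lam)"
      using False rl by (intro frac_le) auto
    hence "- ((exp x - 1) / (r - lam * exp x)) \<le> - (x / (r - lam))"
      by (simp only: minus_divide_left minus_diff_eq)
    thus ?thesis by simp
  qed
  have "lam * (r - 1) * (x / (r - lam)) \<le> lam * (r - 1) * ((exp x - 1) / (r - lam * exp x))"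
    using tangent lam r by (intro mult_left_mono) auto
  hence "(r - lam) * ((exp x - r) / (r - lam * exp x))
     \<le> 1 - r + (1 - lam * (r - 1) / (r - lam)) * x + (S + lam * x\<^sup>2 / (1 - lam - 5 * b))"
    using decomp quad S by (simp add: algebra_simps)
  hence "(exp x - r) / (r - lam * exp x)
     \<le> (1 - r + (1 - lam * (r - 1) / (r - lam)) * x + (S + lam * x\<^sup>2 / (1 - lam - 5 * b))) / (r - lam)"
    using rl by (subst pos_le_divide_eq) (auto simp: mult.commute)
  thus "(1 - lam) / (r * exp (- x) - lam)
      \<le> 1 + (1 - r + (1 - lam * (r - 1) / (r - lam)) * x + (S + lam * x\<^sup>2 / (1 - lam - 5 * b))) / (r - lam)"
    using w by simp
qed

section \<open>Bounded measurable functions and reversible kernels\<close>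

text \<open>The bound holds everywhere on the space rather than almost everywhere, so the class
  depends only on the sigma-algebra. It is closed under products and under \<open>kernel_op\<close>,
  and its members are integrable for every finite measure, so all operator identities hold
  pointwise.\<close>

definition bdd_measurable :: "'a measure \<Rightarrow> ('a \<Rightarrow> real) set" where
  "bdd_measurable M = {h \<in> borel_measurable M. \<exists>B. \<forall>x\<in>space M. \<bar>h x\<bar> \<le> B}"

lemma bdd_measurableI:
  "h \<in> borel_measurable M \<Longrightarrow> (\<And>x. x \<in> space M \<Longrightarrow> \<bar>h x\<bar> \<le> B) \<Longrightarrow> h \<in> bdd_measurable M"
  by (auto simp: bdd_measurable_def)

lemma bdd_measurable_measurable: "h \<in> bdd_measurable M \<Longrightarrow> h \<in> borel_measurable M"
  by (auto simp: bdd_measurable_def)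

lemma bdd_measurable_cong_sets: "sets M = sets N \<Longrightarrow> bdd_measurable M = bdd_measurable N"
  by (simp add: bdd_measurable_def cong: measurable_cong_sets sets_eq_imp_space_eq)

lemma bdd_measurable_const: "(\<lambda>_. a) \<in> bdd_measurable M"
  by (auto simp: bdd_measurable_def)

lemma bdd_measurable_add:
  assumes "h \<in> bdd_measurable M" "k \<in> bdd_measurable M"
  shows "(\<lambda>x. h x + k x) \<in> bdd_measurable M"
proof -
  obtain A B where "\<And>x. x \<in> space M \<Longrightarrow> \<bar>h x\<bar> \<le> A" "\<And>x. x \<in> space M \<Longrightarrow> \<bar>k x\<bar> \<le> B"
    using assms by (auto simp: bdd_measurable_def)
  thus ?thesis using assms
    by (intro bdd_measurableI[where B="A + B"])
       (auto simp: bdd_measurable_def intro!: order_trans[OF abs_triangle_ineq] add_mono)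
qed

lemma bdd_measurable_mult:
  assumes "h \<in> bdd_measurable M" "k \<in> bdd_measurable M"
  shows "(\<lambda>x. h x * k x) \<in> bdd_measurable M"
proof -
  obtain A B where "\<And>x. x \<in> space M \<Longrightarrow> \<bar>h x\<bar> \<le> A" "\<And>x. x \<in> space M \<Longrightarrow> \<bar>k x\<bar> \<le> B"
    using assms by (auto simp: bdd_measurable_def)
  thus ?thesis using assms
    by (intro bdd_measurableI[where B="A * B"])
       (fastforce simp: bdd_measurable_def abs_mult intro!: mult_mono)+
qed

lemma bdd_measurable_diff:
  assumes "h \<in> bdd_measurable M" "k \<in> bdd_measurable M"
  shows "(\<lambda>x. h x - k x) \<in> bdd_measurable M"
  using bdd_measurable_add[OF assms(1) bdd_measurable_mult[OF bdd_measurable_const[of "-1"] assms(2)]]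
  by simp

lemma bdd_measurable_abs: "h \<in> bdd_measurable M \<Longrightarrow> (\<lambda>x. \<bar>h x\<bar>) \<in> bdd_measurable M"
  by (auto simp: bdd_measurable_def)

lemma bdd_measurable_power: "h \<in> bdd_measurable M \<Longrightarrow> (\<lambda>x. h x ^ n) \<in> bdd_measurable M"
  by (induction n) (auto intro: bdd_measurable_const bdd_measurable_mult)

lemmas bdd_measurable_intros =
  bdd_measurable_const bdd_measurable_add bdd_measurable_mult bdd_measurable_diff
  bdd_measurable_abs bdd_measurable_power

lemma (in finite_measure) integrable_bdd_measurable:
  assumes "h \<in> bdd_measurable M" shows "integrable M h"
proof -
  obtain B where "h \<in> borel_measurable M" "\<And>x. x \<in> space M \<Longrightarrow> \<bar>h x\<bar> \<le> B"
    using assms by (auto simp: bdd_measurable_def)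
  thus ?thesis by (intro integrable_const_bound[where B=B]) auto
qed

section \<open>A Markov kernel as an operator on bounded measurable functions\<close>

locale markov_kernel =
  fixes M :: "'a measure" and P :: "'a \<Rightarrow> 'a measure"
  assumes kernel: "P \<in> M \<rightarrow>\<^sub>M prob_algebra M"
begin

lemma kernel_subprob: "P \<in> M \<rightarrow>\<^sub>M subprob_algebra M"
  using kernel by (rule measurable_prob_algebraD)

lemma kernelD: "x \<in> space M \<Longrightarrow> prob_space (P x)" "x \<in> space M \<Longrightarrow> sets (P x) = sets M"
  using measurable_space[OF kernel] by (auto simp: space_prob_algebra)

lemma integrable_kernel: "h \<in> bdd_measurable M \<Longrightarrow> x \<in> space M \<Longrightarrow> integrable (P x) h"
  using finite_measure.integrable_bdd_measurable[of "P x" h] kernelD[of x]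
    prob_space.finite_measure[of "P x"] bdd_measurable_cong_sets[of "P x" M] by auto

lemma kernel_op_lincomb:
  "h \<in> bdd_measurable M \<Longrightarrow> k \<in> bdd_measurable M \<Longrightarrow> x \<in> space M \<Longrightarrow>
    kernel_op P (\<lambda>y. a * h y + b * k y) x = a * kernel_op P h x + b * kernel_op P k x"
  unfolding kernel_op_def by (simp add: integrable_kernel)

lemma kernel_op_const: "x \<in> space M \<Longrightarrow> kernel_op P (\<lambda>_. a) x = a"
  unfolding kernel_op_def using prob_space.prob_space[OF kernelD(1)] by simp

lemma kernel_op_mono:
  "h \<in> bdd_measurable M \<Longrightarrow> k \<in> bdd_measurable M \<Longrightarrow> x \<in> space M \<Longrightarrow>
    (\<And>y. y \<in> space M \<Longrightarrow> h y \<le> k y) \<Longrightarrow> kernel_op P h x \<le> kernel_op P k x"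
  unfolding kernel_op_def
  using sets_eq_imp_space_eq[OF kernelD(2)] by (intro integral_mono) (auto simp: integrable_kernel)

lemma abs_kernel_op_le:
  "\<bar>kernel_op P h x\<bar> \<le> kernel_op P (\<lambda>y. \<bar>h y\<bar>) x"
  unfolding kernel_op_def by (rule integral_abs_bound)

lemma kernel_op_bdd_measurable:
  assumes h: "h \<in> bdd_measurable M"
  shows "kernel_op P h \<in> bdd_measurable M"
proof -
  obtain B where B: "\<And>x. x \<in> space M \<Longrightarrow> \<bar>h x\<bar> \<le> B"
    using h by (auto simp: bdd_measurable_def)
  show ?thesis
  proof (rule bdd_measurableI[where B=B])
    show "kernel_op P h \<in> borel_measurable M"
      unfolding kernel_op_def
      by (rule measurable_compose[OF kernel_subprob integral_measurable_subprob_algebra])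
         (rule bdd_measurable_measurable[OF h])
    fix x assume x: "x \<in> space M"
    have "kernel_op P (\<lambda>y. \<bar>h y\<bar>) x \<le> kernel_op P (\<lambda>_. B) x"
      using B by (intro kernel_op_mono bdd_measurable_intros h x)
    thus "\<bar>kernel_op P h x\<bar> \<le> B"
      using abs_kernel_op_le[of h x] kernel_op_const[OF x, of B] by linarith
  qed
qed

end

section \<open>Reversibility and the quadratic form of the kernel\<close>

locale reversible_chain = prob_space \<pi> + markov_kernel M P
  for \<pi> M :: "'a measure" and P :: "'a \<Rightarrow> 'a measure" +
  assumes sets_pi: "sets \<pi> = sets M"
    and reversible: "reversible_kernel P \<pi>"
begin

lemma space_pi: "space \<pi> = space M"
  using sets_pi by (rule sets_eq_imp_space_eq)

lemma bdd_measurable_pi: "bdd_measurable \<pi> = bdd_measurable M"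
  using sets_pi by (rule bdd_measurable_cong_sets)

lemma integrable_pi: "h \<in> bdd_measurable M \<Longrightarrow> integrable \<pi> h"
  using integrable_bdd_measurable by (simp add: bdd_measurable_pi)

lemma bdd_measurable_L2: "h \<in> bdd_measurable M \<Longrightarrow> h \<in> L2 \<pi>"
  unfolding L2_def using bdd_measurable_measurable[of h \<pi>]
  by (auto simp: bdd_measurable_pi intro!: integrable_pi bdd_measurable_intros)

lemma kernel_op_symmetric:
  "h \<in> bdd_measurable M \<Longrightarrow> k \<in> bdd_measurable M \<Longrightarrow>
    (\<integral>x. kernel_op P h x * k x \<partial>\<pi>) = (\<integral>x. h x * kernel_op P k x \<partial>\<pi>)"
  using reversible bdd_measurable_L2 by (auto simp: reversible_kernel_def inner_L2_def)

text \<open>Symmetry is tested against the constant 1, which the kernel fixes.\<close>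

lemma integral_kernel_op:
  assumes h: "h \<in> bdd_measurable M"
  shows "(\<integral>x. kernel_op P h x \<partial>\<pi>) = (\<integral>x. h x \<partial>\<pi>)"
proof -
  have "(\<integral>x. h x * kernel_op P (\<lambda>_. 1) x \<partial>\<pi>) = (\<integral>x. h x \<partial>\<pi>)"
    by (intro Bochner_Integration.integral_cong) (auto simp: kernel_op_const space_pi)
  thus ?thesis using kernel_op_symmetric[OF h bdd_measurable_const[of 1]] by simp
qed

text \<open>Both sides are homogeneous of degree two, so \<open>v\<close> can be scaled to unit norm
  and compared with the supremum that defines \<open>lambda_r\<close>.\<close>

lemma dirichlet_form_mean_zero:
  assumes gap: "lambda_r P \<pi> < 1" and v: "v \<in> bdd_measurable M" and mean: "(\<integral>x. v x \<partial>\<pi>) = 0"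
  shows "(\<integral>x. v x * kernel_op P v x \<partial>\<pi>) \<le> lambda_r_plus P \<pi> * (\<integral>x. (v x)\<^sup>2 \<partial>\<pi>)"
proof -
  define N where "N = (\<integral>x. (v x)\<^sup>2 \<partial>\<pi>)"
  have N0: "0 \<le> N" unfolding N_def by simp
  show ?thesis
  proof (cases "N = 0")
    \<comment> \<open>A null function cannot be normalized, but then both sides are 0.\<close>
    case True
    have "AE x in \<pi>. (v x)\<^sup>2 = 0"
      using True unfolding N_def
      by (subst (asm) integral_nonneg_eq_0_iff_AE) (auto intro!: integrable_pi bdd_measurable_intros v)
    hence "AE x in \<pi>. v x * kernel_op P v x = 0" by eventually_elim simp
    hence "(\<integral>x. v x * kernel_op P v x \<partial>\<pi>) = 0" by (rule integral_eq_zero_AE)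
    thus ?thesis using True by (simp add: N_def)
  next
    case False
    hence N: "0 < N" using N0 by simp
    define a where "a = 1 / sqrt N"
    have a2: "a * a = 1 / N" using N by (simp add: a_def)
    define w where "w = (\<lambda>x. a * v x)"
    have w: "w \<in> bdd_measurable M" unfolding w_def by (intro bdd_measurable_intros v)
    have Pw: "kernel_op P w x = a * kernel_op P v x" for x
      unfolding w_def kernel_op_def by simp
    have ww: "inner_L2 \<pi> w w = 1"
    proof -
      have "inner_L2 \<pi> w w = (\<integral>x. (a * a) * (v x)\<^sup>2 \<partial>\<pi>)"
        unfolding inner_L2_def w_def by (simp add: power2_eq_square ac_simps)
      also have "\<dots> = 1" using N by (simp add: a2 flip: N_def)
      finally show ?thesis .
    qed
    have "inner_L2 \<pi> w (kernel_op P w) = (\<integral>x. (a * a) * (v x * kernel_op P v x) \<partial>\<pi>)"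
      unfolding inner_L2_def Pw by (simp add: w_def ac_simps)
    hence wPw: "inner_L2 \<pi> w (kernel_op P w) = (\<integral>x. v x * kernel_op P v x \<partial>\<pi>) / N"
      by (simp add: a2)
    have "w \<in> L2_zero \<pi>" using bdd_measurable_L2[OF w] mean by (simp add: L2_zero_def w_def)
    moreover have "norm_L2 \<pi> w = 1" by (simp add: norm_L2_def ww)
    ultimately have "ereal (inner_L2 \<pi> w (kernel_op P w)) \<le> lambda_r P \<pi>"
      unfolding lambda_r_def by (intro SUP_upper) auto
    \<comment> \<open>The gap rules out the value \<infinity>, where the conversion to a real number
      would give 0; the value -\<infinity> is absorbed by the maximum with 0.\<close>
    also have "\<dots> \<le> ereal (lambda_r_plus P \<pi>)"
      using gap unfolding lambda_r_plus_def by (cases "lambda_r P \<pi>") (auto simp: max_def zero_ereal_def)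
    finally have "(\<integral>x. v x * kernel_op P v x \<partial>\<pi>) / N \<le> lambda_r_plus P \<pi>" by (simp add: wPw)
    thus ?thesis using N by (simp add: divide_simps flip: N_def)
  qed
qed

text \<open>Split \<open>u = m + v\<close> into its mean and a mean-zero part. The cross terms
  vanish because \<open>v\<close> and \<open>kernel_op P v\<close> both have mean 0, and the second
  moment of \<open>v\<close> is that of \<open>u\<close> minus \<open>m^2\<close>.\<close>

lemma dirichlet_form_bound:
  assumes gap: "lambda_r P \<pi> < 1" and u: "u \<in> bdd_measurable M"
  shows "(\<integral>x. u x * kernel_op P u x \<partial>\<pi>)
    \<le> (1 - lambda_r_plus P \<pi>) * (\<integral>x. u x \<partial>\<pi>)\<^sup>2 + lambda_r_plus P \<pi> * (\<integral>x. (u x)\<^sup>2 \<partial>\<pi>)"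
proof -
  define m where "m = (\<integral>x. u x \<partial>\<pi>)"
  define v where "v = (\<lambda>x. u x - m)"
  note [intro!] = bdd_measurable_intros integrable_pi kernel_op_bdd_measurable u
  have v [intro!]: "v \<in> bdd_measurable M" unfolding v_def by auto
  have v0: "(\<integral>x. v x \<partial>\<pi>) = 0"
  proof -
    have "(\<integral>x. v x \<partial>\<pi>) = (\<integral>x. u x \<partial>\<pi>) - (\<integral>x. m \<partial>\<pi>)"
      unfolding v_def by (intro Bochner_Integration.integral_diff) auto
    thus ?thesis by (simp add: m_def prob_space)
  qed
  have Pu: "kernel_op P u x = m + kernel_op P v x" if "x \<in> space M" for x
  proof -
    have "kernel_op P (\<lambda>y. 1 * v y + 1 * m) x = 1 * kernel_op P v x + 1 * kernel_op P (\<lambda>_. m) x"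
      using that by (intro kernel_op_lincomb) auto
    thus ?thesis using kernel_op_const[OF that, of m] by (simp add: v_def)
  qed
  have "(\<integral>x. u x * kernel_op P u x \<partial>\<pi>)
      = (\<integral>x. m\<^sup>2 + m * v x + m * kernel_op P v x + v x * kernel_op P v x \<partial>\<pi>)"
    by (intro Bochner_Integration.integral_cong refl)
       (simp add: space_pi Pu, simp add: v_def algebra_simps power2_eq_square)
  also have "\<dots> = m\<^sup>2 + m * (\<integral>x. v x \<partial>\<pi>) + m * (\<integral>x. kernel_op P v x \<partial>\<pi>)
      + (\<integral>x. v x * kernel_op P v x \<partial>\<pi>)"
    by (subst Bochner_Integration.integral_add, (force)+)+ (simp add: prob_space)
  also have "\<dots> = m\<^sup>2 + (\<integral>x. v x * kernel_op P v x \<partial>\<pi>)"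
    by (simp add: integral_kernel_op[OF v] v0)
  also have "\<dots> \<le> m\<^sup>2 + lambda_r_plus P \<pi> * (\<integral>x. (v x)\<^sup>2 \<partial>\<pi>)"
    using dirichlet_form_mean_zero[OF gap v v0] by simp
  also have "(\<integral>x. (v x)\<^sup>2 \<partial>\<pi>) = (\<integral>x. (u x)\<^sup>2 + (- 2 * m * u x + m\<^sup>2) \<partial>\<pi>)"
    by (simp add: v_def power2_eq_square algebra_simps)
  also have "\<dots> = (\<integral>x. (u x)\<^sup>2 \<partial>\<pi>) - m\<^sup>2"
    by (simp add: integrable_pi bdd_measurable_intros u prob_space power2_eq_square flip: m_def)
  finally show ?thesis by (simp add: m_def algebra_simps)
qed

end

section \<open>The exponentially tilted operator\<close>

text \<open>Cauchy-Schwarz for \<open>u = (u * sqrt W) * (1 / sqrt W)\<close>, carried out by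
  completing a square. The majorant \<open>G\<close> stands in for \<open>a / W\<close>, so that
  only \<open>G\<close>, later a quadratic polynomial in \<open>f\<close>, has to be integrated
  exactly.\<close>

lemma (in prob_space) square_expectation_le_weighted:
  assumes u: "u \<in> bdd_measurable M" and W: "W \<in> bdd_measurable M" and G: "G \<in> bdd_measurable M"
    and W0: "\<And>x. x \<in> space M \<Longrightarrow> 0 < W x"
    and WG: "\<And>x. x \<in> space M \<Longrightarrow> a / W x \<le> G x"
    and G1: "expectation G \<le> 1" and a: "0 \<le> a"
  shows "a * (expectation u)\<^sup>2 \<le> expectation (\<lambda>x. (u x)\<^sup>2 * W x)"
proof -
  define m where "m = expectation u"
  note [intro!] = bdd_measurable_intros integrable_bdd_measurable u W G
  have pointwise: "2 * a * m * u x \<le> (u x)\<^sup>2 * W x + a * m\<^sup>2 * G x" if x: "x \<in> space M" for x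
  proof -
    \<comment> \<open>The constant \<open>a * m\<close> is chosen so that, after integration, the
      cross term contributes \<open>2 * a * m^2\<close> and the last term at most
      \<open>a * m^2\<close>.\<close>
    have "0 \<le> (u x * W x - a * m)\<^sup>2 / W x" using W0[OF x] by simp
    also have "\<dots> = (u x)\<^sup>2 * W x - 2 * a * m * u x + a * m\<^sup>2 * (a / W x)"
      using W0[OF x] by (simp add: field_simps power2_eq_square)
    also have "a * m\<^sup>2 * (a / W x) \<le> a * m\<^sup>2 * G x"
      using WG[OF x] a by (intro mult_left_mono) auto
    finally show ?thesis by simp
  qed
  have "2 * a * m\<^sup>2 = expectation (\<lambda>x. 2 * a * m * u x)" by (simp add: m_def power2_eq_square)
  also have "\<dots> \<le> expectation (\<lambda>x. (u x)\<^sup>2 * W x + a * m\<^sup>2 * G x)"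
    using pointwise
    by (intro integral_mono integrable_bdd_measurable bdd_measurable_intros u W G)
  also have "\<dots> = expectation (\<lambda>x. (u x)\<^sup>2 * W x) + a * m\<^sup>2 * expectation G"
    by (subst Bochner_Integration.integral_add) auto
  also have "a * m\<^sup>2 * expectation G \<le> a * m\<^sup>2 * 1"
    using G1 a by (intro mult_left_mono) auto
  finally show ?thesis by (simp add: m_def)
qed

text \<open>For positive \<open>F\<close> this operator is conjugate, through multiplication by
  \<open>sqrt F\<close>, to \<open>sqrt F\<close> times \<open>P\<close> times
  \<open>sqrt F\<close>. Working with the weight \<open>F\<close> in the integrals instead avoids
  the square roots.\<close>

definition tilted_op :: "('a \<Rightarrow> 'a measure) \<Rightarrow> ('a \<Rightarrow> real) \<Rightarrow> ('a \<Rightarrow> real) \<Rightarrow> 'a \<Rightarrow> real" where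
  "tilted_op P F h = kernel_op P (\<lambda>y. F y * h y)"

context markov_kernel
begin

lemma tilted_op_bdd_measurable:
  "F \<in> bdd_measurable M \<Longrightarrow> h \<in> bdd_measurable M \<Longrightarrow> tilted_op P F h \<in> bdd_measurable M"
  unfolding tilted_op_def by (intro kernel_op_bdd_measurable bdd_measurable_intros)

lemma tilted_op_nonneg:
  assumes "\<And>y. y \<in> space M \<Longrightarrow> 0 \<le> F y" "\<And>y. y \<in> space M \<Longrightarrow> 0 \<le> h y" "x \<in> space M"
  shows "0 \<le> tilted_op P F h x"
  unfolding tilted_op_def kernel_op_def
  using assms sets_eq_imp_space_eq[OF kernelD(2)] by (intro integral_nonneg_AE AE_I2) auto

lemma tilted_op_pow_bdd_measurable:
  "F \<in> bdd_measurable M \<Longrightarrow> h \<in> bdd_measurable M \<Longrightarrow> (tilted_op P F ^^ n) h \<in> bdd_measurable M"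
  by (induction n) (auto intro: tilted_op_bdd_measurable)

end

section \<open>From the quadratic form to norms and powers of the tilted operator\<close>

context reversible_chain
begin

text \<open>Reversibility makes the two mixed terms equal, so the form expands like a symmetric
  bilinear form; this is the input for polarization.\<close>

lemma tilted_form_expand:
  assumes F: "F \<in> bdd_measurable M" and h: "h \<in> bdd_measurable M" and k: "k \<in> bdd_measurable M"
  shows "(\<integral>x. F x * (a * h x + k x) * tilted_op P F (\<lambda>y. a * h y + k y) x \<partial>\<pi>)
    = a\<^sup>2 * (\<integral>x. F x * h x * tilted_op P F h x \<partial>\<pi>)
      + 2 * a * (\<integral>x. F x * k x * tilted_op P F h x \<partial>\<pi>)
      + (\<integral>x. F x * k x * tilted_op P F k x \<partial>\<pi>)"
proof -
  note [intro!] = bdd_measurable_intros integrable_pi tilted_op_bdd_measurable F h k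
  have sym: "(\<integral>x. F x * h x * tilted_op P F k x \<partial>\<pi>) = (\<integral>x. F x * k x * tilted_op P F h x \<partial>\<pi>)"
    unfolding tilted_op_def by (subst kernel_op_symmetric[symmetric]) (auto simp: ac_simps)
  have lin: "tilted_op P F (\<lambda>y. a * h y + k y) x = a * tilted_op P F h x + tilted_op P F k x"
    if "x \<in> space M" for x
  proof -
    have "kernel_op P (\<lambda>y. a * (F y * h y) + 1 * (F y * k y)) x
        = a * kernel_op P (\<lambda>y. F y * h y) x + 1 * kernel_op P (\<lambda>y. F y * k y) x"
      using that by (intro kernel_op_lincomb) auto
    thus ?thesis by (simp add: tilted_op_def algebra_simps)
  qed
  have "(\<integral>x. F x * (a * h x + k x) * tilted_op P F (\<lambda>y. a * h y + k y) x \<partial>\<pi>)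
    = (\<integral>x. a\<^sup>2 * (F x * h x * tilted_op P F h x) + a * (F x * k x * tilted_op P F h x)
        + a * (F x * h x * tilted_op P F k x) + F x * k x * tilted_op P F k x \<partial>\<pi>)"
    by (intro Bochner_Integration.integral_cong refl)
       (simp add: lin space_pi, simp add: algebra_simps power2_eq_square)
  also have "\<dots> = a\<^sup>2 * (\<integral>x. F x * h x * tilted_op P F h x \<partial>\<pi>)
      + a * (\<integral>x. F x * k x * tilted_op P F h x \<partial>\<pi>)
      + a * (\<integral>x. F x * h x * tilted_op P F k x \<partial>\<pi>)
      + (\<integral>x. F x * k x * tilted_op P F k x \<partial>\<pi>)"
    by (simp add: integrable_pi bdd_measurable_intros tilted_op_bdd_measurable F h k)
  finally show ?thesis by (simp add: sym)
qed

text \<open>The lower bound on the form is free: \<open>tilted_op\<close> preserves positivity, so passing to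
  \<open>\<bar>h\<bar>\<close> turns the one-sided hypothesis into a two-sided one, and the spectrum of \<open>P\<close> near \<open>-1\<close> is harmless.\<close>

lemma tilted_form_abs_bound:
  assumes F: "F \<in> bdd_measurable M" and F0: "\<And>x. x \<in> space M \<Longrightarrow> 0 \<le> F x"
    and form: "\<And>u. u \<in> bdd_measurable M \<Longrightarrow>
      (\<integral>x. F x * u x * tilted_op P F u x \<partial>\<pi>) \<le> L * (\<integral>x. F x * (u x)\<^sup>2 \<partial>\<pi>)"
    and h: "h \<in> bdd_measurable M"
  shows "\<bar>\<integral>x. F x * h x * tilted_op P F h x \<partial>\<pi>\<bar> \<le> L * (\<integral>x. F x * (h x)\<^sup>2 \<partial>\<pi>)"
proof -
  note [intro!] = bdd_measurable_intros integrable_pi tilted_op_bdd_measurable F h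
  have "\<bar>\<integral>x. F x * h x * tilted_op P F h x \<partial>\<pi>\<bar> \<le> (\<integral>x. \<bar>F x * h x * tilted_op P F h x\<bar> \<partial>\<pi>)"
    by (rule integral_abs_bound)
  also have "\<dots> \<le> (\<integral>x. F x * \<bar>h x\<bar> * tilted_op P F (\<lambda>y. \<bar>h y\<bar>) x \<partial>\<pi>)"
  proof (rule integral_mono)
    fix x assume "x \<in> space \<pi>"
    hence x: "x \<in> space M" by (simp add: space_pi)
    have "\<bar>tilted_op P F h x\<bar> \<le> kernel_op P (\<lambda>y. \<bar>F y * h y\<bar>) x"
      unfolding tilted_op_def by (rule abs_kernel_op_le)
    also have "\<dots> \<le> tilted_op P F (\<lambda>y. \<bar>h y\<bar>) x"
      unfolding tilted_op_def using F0
      by (intro kernel_op_mono bdd_measurable_intros F h x) (simp add: abs_mult)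
    finally show "\<bar>F x * h x * tilted_op P F h x\<bar> \<le> F x * \<bar>h x\<bar> * tilted_op P F (\<lambda>y. \<bar>h y\<bar>) x"
      using F0[OF x] by (auto simp: abs_mult intro!: mult_mono)
  qed auto
  also have "\<dots> \<le> L * (\<integral>x. F x * \<bar>h x\<bar>\<^sup>2 \<partial>\<pi>)" by (intro form) auto
  finally show ?thesis by simp
qed

text \<open>The norm of a symmetric operator is at most its numerical radius. Polarization at
  \<open>L * h + k\<close> and \<open>- L * h + k\<close> with \<open>k = tilted_op P F h\<close>
  isolates the squared norm of \<open>k\<close>; the two form bounds are then summed by the
  parallelogram law. The factor \<open>L\<close> in front of \<open>h\<close> makes the resulting
  multiple of the norm of \<open>k\<close> small enough to be absorbed on the left.\<close>

lemma tilted_contraction: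
  assumes F: "F \<in> bdd_measurable M" and F0: "\<And>x. x \<in> space M \<Longrightarrow> 0 \<le> F x"
    and form: "\<And>u. u \<in> bdd_measurable M \<Longrightarrow>
      (\<integral>x. F x * u x * tilted_op P F u x \<partial>\<pi>) \<le> L * (\<integral>x. F x * (u x)\<^sup>2 \<partial>\<pi>)"
    and L: "0 < L" and h: "h \<in> bdd_measurable M"
  shows "(\<integral>x. F x * (tilted_op P F h x)\<^sup>2 \<partial>\<pi>) \<le> L\<^sup>2 * (\<integral>x. F x * (h x)\<^sup>2 \<partial>\<pi>)"
proof -
  note [intro!] = bdd_measurable_intros integrable_pi tilted_op_bdd_measurable F h
  define k where "k = tilted_op P F h"
  have k [intro!]: "k \<in> bdd_measurable M" unfolding k_def by auto
  have sq: "(\<integral>x. F x * (a * h x + k x)\<^sup>2 \<partial>\<pi>)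
      = a\<^sup>2 * (\<integral>x. F x * (h x)\<^sup>2 \<partial>\<pi>) + 2 * a * (\<integral>x. F x * h x * k x \<partial>\<pi>) + (\<integral>x. F x * (k x)\<^sup>2 \<partial>\<pi>)" for a
  proof -
    have "(\<integral>x. F x * (a * h x + k x)\<^sup>2 \<partial>\<pi>)
        = (\<integral>x. a\<^sup>2 * (F x * (h x)\<^sup>2) + 2 * a * (F x * h x * k x) + F x * (k x)\<^sup>2 \<partial>\<pi>)"
      by (simp add: algebra_simps power2_eq_square)
    also have "\<dots> = a\<^sup>2 * (\<integral>x. F x * (h x)\<^sup>2 \<partial>\<pi>) + 2 * a * (\<integral>x. F x * h x * k x \<partial>\<pi>) + (\<integral>x. F x * (k x)\<^sup>2 \<partial>\<pi>)"
      by (simp add: integrable_pi bdd_measurable_intros F h k)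
    finally show ?thesis .
  qed
  define Q where "Q a = (\<integral>x. F x * (a * h x + k x) * tilted_op P F (\<lambda>y. a * h y + k y) x \<partial>\<pi>)" for a
  have Q: "\<bar>Q a\<bar> \<le> L * (\<integral>x. F x * (a * h x + k x)\<^sup>2 \<partial>\<pi>)" for a
    unfolding Q_def by (rule tilted_form_abs_bound[OF F F0 form]) auto
  have "Q L - Q (- L) = 4 * L * (\<integral>x. F x * k x * tilted_op P F h x \<partial>\<pi>)"
    unfolding Q_def tilted_form_expand[OF F h k] by simp
  also have "\<dots> = 4 * L * (\<integral>x. F x * (k x)\<^sup>2 \<partial>\<pi>)"
    by (simp add: k_def power2_eq_square ac_simps)
  finally have "4 * L * (\<integral>x. F x * (k x)\<^sup>2 \<partial>\<pi>)
      \<le> L * ((\<integral>x. F x * (L * h x + k x)\<^sup>2 \<partial>\<pi>) + (\<integral>x. F x * (- L * h x + k x)\<^sup>2 \<partial>\<pi>))"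
    using Q[of L] Q[of "- L"] unfolding distrib_left by linarith
  also have "\<dots> = L * (2 * (L\<^sup>2 * (\<integral>x. F x * (h x)\<^sup>2 \<partial>\<pi>) + (\<integral>x. F x * (k x)\<^sup>2 \<partial>\<pi>)))"
    unfolding sq by simp
  finally have "L * (2 * (\<integral>x. F x * (k x)\<^sup>2 \<partial>\<pi>)) \<le> L * (2 * (L\<^sup>2 * (\<integral>x. F x * (h x)\<^sup>2 \<partial>\<pi>)))"
    by (simp add: algebra_simps)
  thus ?thesis using L by (simp add: k_def)
qed

text \<open>Iterating the contraction from the constant 1, whose squared weighted norm is the
  integral of \<open>F\<close>, bounds the norm of the n-th iterate. Pairing that iterate with 1 in
  the weighted inner product then costs one Cauchy-Schwarz.\<close>

lemma tilted_op_pow_bound: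
  assumes F: "F \<in> bdd_measurable M" and F0: "\<And>x. x \<in> space M \<Longrightarrow> 0 \<le> F x"
    and form: "\<And>u. u \<in> bdd_measurable M \<Longrightarrow>
      (\<integral>x. F x * u x * tilted_op P F u x \<partial>\<pi>) \<le> L * (\<integral>x. F x * (u x)\<^sup>2 \<partial>\<pi>)"
    and L: "0 < L"
  shows "(\<integral>x. F x * (tilted_op P F ^^ n) (\<lambda>_. 1) x \<partial>\<pi>) \<le> L ^ n * (\<integral>x. F x \<partial>\<pi>)"
proof -
  define v where "v = (\<lambda>n. (tilted_op P F ^^ n) (\<lambda>_. 1))"
  have v [intro!]: "v n \<in> bdd_measurable M" for n
    unfolding v_def by (intro tilted_op_pow_bdd_measurable F bdd_measurable_const)
  note [intro!] = bdd_measurable_intros integrable_pi F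
  have norm: "(\<integral>x. F x * (v n x)\<^sup>2 \<partial>\<pi>) \<le> (L ^ n)\<^sup>2 * (\<integral>x. F x \<partial>\<pi>)" for n
  proof (induction n)
    case (Suc n)
    have "(\<integral>x. F x * (v (Suc n) x)\<^sup>2 \<partial>\<pi>) \<le> L\<^sup>2 * (\<integral>x. F x * (v n x)\<^sup>2 \<partial>\<pi>)"
      using tilted_contraction[OF F F0 form L v[of n]] by (simp add: v_def)
    also have "\<dots> \<le> L\<^sup>2 * ((L ^ n)\<^sup>2 * (\<integral>x. F x \<partial>\<pi>))"
      using Suc by (intro mult_left_mono) auto
    finally show ?case by (simp add: power_mult_distrib mult.assoc)
  qed (simp add: v_def)
  \<comment> \<open>Cauchy-Schwarz in the form \<open>2 * a * b \<le> a^2 + b^2\<close> with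
    \<open>a = L ^ n\<close>, balanced because both squares integrate to at most
    \<open>L ^ (2 * n)\<close> times the integral of \<open>F\<close>.\<close>
  have "2 * (L ^ n * (\<integral>x. F x * v n x \<partial>\<pi>)) = (\<integral>x. 2 * L ^ n * (F x * v n x) \<partial>\<pi>)"
    by simp
  also have "\<dots> \<le> (\<integral>x. (L ^ n)\<^sup>2 * F x + F x * (v n x)\<^sup>2 \<partial>\<pi>)"
  proof (rule integral_mono)
    fix x assume "x \<in> space \<pi>"
    hence "0 \<le> F x * (L ^ n - v n x)\<^sup>2" using F0 by (simp add: space_pi)
    thus "2 * L ^ n * (F x * v n x) \<le> (L ^ n)\<^sup>2 * F x + F x * (v n x)\<^sup>2"
      by (simp add: power2_diff algebra_simps)
  qed (intro integrable_pi bdd_measurable_intros F v)+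
  also have "\<dots> = (L ^ n)\<^sup>2 * (\<integral>x. F x \<partial>\<pi>) + (\<integral>x. F x * (v n x)\<^sup>2 \<partial>\<pi>)"
    by (subst Bochner_Integration.integral_add) auto
  also have "\<dots> \<le> 2 * (L ^ n * (L ^ n * (\<integral>x. F x \<partial>\<pi>)))"
    using norm[of n] by (simp add: power2_eq_square algebra_simps)
  finally show ?thesis using L by (simp add: v_def)
qed

end

section \<open>The Markov property\<close>

lemma space_history: "space (history \<Omega> M X n) = space \<Omega>"
  by (simp add: history_def space_measure_of_conv)

lemma subalgebra_history:
  assumes "markov_chain \<Omega> M P X"
  shows "subalgebra \<Omega> (history \<Omega> M X n)"
proof -
  have "(\<Union>i\<in>{1..n}. {X i -` B \<inter> space \<Omega> | B. B \<in> sets M}) \<subseteq> sets \<Omega>"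
    using assms by (auto simp: markov_chain_def intro: measurable_sets)
  thus ?thesis
    using sets.sets_into_space[of _ \<Omega>] unfolding subalgebra_def space_history unfolding history_def
    by (subst sets_measure_of) (auto intro!: sets.sigma_sets_subset)
qed

lemma measurable_history:
  assumes "markov_chain \<Omega> M P X" and i: "i \<in> {1..n}"
  shows "X i \<in> history \<Omega> M X n \<rightarrow>\<^sub>M M"
proof (rule measurableI)
  have X: "X i \<in> \<Omega> \<rightarrow>\<^sub>M M" using assms by (auto simp: markov_chain_def)
  show "X i \<omega> \<in> space M" if "\<omega> \<in> space (history \<Omega> M X n)" for \<omega>
    using that measurable_space[OF X] by (simp add: space_history)
  show "X i -` B \<inter> space (history \<Omega> M X n) \<in> sets (history \<Omega> M X n)" if "B \<in> sets M" for B
  proof -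
    have "X i -` B \<inter> space \<Omega> \<in> (\<Union>i\<in>{1..n}. {X i -` B \<inter> space \<Omega> | B. B \<in> sets M})"
      using that i by blast
    thus ?thesis unfolding space_history unfolding history_def by (intro in_measure_of) auto
  qed
qed

text \<open>The chain hypothesis speaks of events only. Reweighting \<open>\<Omega>\<close> by the
  density \<open>Z\<close> turns it into an identity of measures, namely that the law of
  \<open>X (Suc n)\<close> is the law of \<open>X n\<close> composed with \<open>P\<close>;
  integrating \<open>h\<close> against both sides gives the claim.\<close>

lemma (in markov_kernel) markov_property:
  assumes \<Omega>: "prob_space \<Omega>" and chain: "markov_chain \<Omega> M P X" and n: "1 \<le> n"
    and Z: "Z \<in> bdd_measurable (history \<Omega> M X n)" and Z0: "\<And>\<omega>. \<omega> \<in> space \<Omega> \<Longrightarrow> 0 \<le> Z \<omega>"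
    and h: "h \<in> bdd_measurable M" and h0: "\<And>x. x \<in> space M \<Longrightarrow> 0 \<le> h x"
  shows "(\<integral>\<omega>. Z \<omega> * h (X (Suc n) \<omega>) \<partial>\<Omega>) = (\<integral>\<omega>. Z \<omega> * kernel_op P h (X n \<omega>) \<partial>\<Omega>)"
proof -
  interpret \<Omega>: prob_space \<Omega> by (rule \<Omega>)
  let ?H = "history \<Omega> M X n"
  interpret H: finite_measure_subalgebra \<Omega> ?H
    by unfold_locales (rule subalgebra_history[OF chain])
  have X [measurable]: "X n \<in> \<Omega> \<rightarrow>\<^sub>M M" "X (Suc n) \<in> \<Omega> \<rightarrow>\<^sub>M M"
    using chain n by (auto simp: markov_chain_def)
  have spX: "X n \<omega> \<in> space M" "X (Suc n) \<omega> \<in> space M" if "\<omega> \<in> space \<Omega>" for \<omega>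
    using that measurable_space[OF X(1)] measurable_space[OF X(2)] by auto
  \<comment> \<open>\<open>bind\<close> takes a default value on a measure with empty space, so this
    case has to be excluded.\<close>
  have ne: "space M \<noteq> {}" using spX \<Omega>.not_empty by auto
  note [measurable] = kernel_subprob bdd_measurable_measurable[OF h]
  have ZH [measurable]: "Z \<in> borel_measurable ?H" by (rule bdd_measurable_measurable[OF Z])
  have Zm [measurable]: "Z \<in> borel_measurable \<Omega>"
    by (rule measurable_from_subalg[OF H.subalg ZH])
  have Zb: "Z \<in> bdd_measurable \<Omega>" using Z Zm by (auto simp: bdd_measurable_def space_history)
  define N where "N = density \<Omega> (\<lambda>\<omega>. ennreal (Z \<omega>))"
  have [simp]: "space N = space \<Omega>" "sets N = sets \<Omega>" by (simp_all add: N_def)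
  have XN [measurable]: "X n \<in> N \<rightarrow>\<^sub>M M" "X (Suc n) \<in> N \<rightarrow>\<^sub>M M" by (simp_all add: N_def)
  have "distr N M (X (Suc n)) = distr N M (X n) \<bind> P"
  proof (rule measure_eqI)
    show "sets (distr N M (X (Suc n))) = sets (distr N M (X n) \<bind> P)"
      using ne by (subst sets_bind[where N=M]) (auto simp: kernelD)
    fix B assume "B \<in> sets (distr N M (X (Suc n)))"
    hence B [measurable]: "B \<in> sets M" by simp
    define I where "I = X (Suc n) -` B \<inter> space \<Omega>"
    have I [measurable]: "I \<in> sets \<Omega>" unfolding I_def using X(2) B by (rule measurable_sets)
    have pm: "(\<lambda>\<omega>. measure (P (X n \<omega>)) B) \<in> bdd_measurable \<Omega>"
      using kernelD(1)[OF spX(1)]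
      by (intro bdd_measurableI[where B=1]) (auto intro: prob_space.prob_le_1)
    have ind: "(indicator I :: _ \<Rightarrow> real) \<in> bdd_measurable \<Omega>"
      by (intro bdd_measurableI[where B=1]) (auto simp: indicator_def)
    have "emeasure (distr N M (X (Suc n))) B = (\<integral>\<^sup>+\<omega>. ennreal (Z \<omega>) * indicator I \<omega> \<partial>\<Omega>)"
      by (simp add: emeasure_distr N_def emeasure_density I_def)
    also have "\<dots> = (\<integral>\<^sup>+\<omega>. ennreal (Z \<omega> * indicator I \<omega>) \<partial>\<Omega>)"
      by (intro nn_integral_cong) (auto simp: indicator_def)
    also have "\<dots> = ennreal (\<integral>\<omega>. Z \<omega> * indicator I \<omega> \<partial>\<Omega>)"
      using Z0 by (intro nn_integral_eq_integral \<Omega>.integrable_bdd_measurable bdd_measurable_mult Zb ind AE_I2) auto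
    \<comment> \<open>Since \<open>Z\<close> is measurable for the history, the indicator may be
      replaced by its conditional expectation.\<close>
    also have "(\<integral>\<omega>. Z \<omega> * indicator I \<omega> \<partial>\<Omega>) = (\<integral>\<omega>. Z \<omega> * real_cond_exp \<Omega> ?H (indicator I) \<omega> \<partial>\<Omega>)"
      by (rule H.real_cond_exp_intg(2)[symmetric])
         (auto intro!: \<Omega>.integrable_bdd_measurable bdd_measurable_mult Zb ind)
    also have "\<dots> = (\<integral>\<omega>. Z \<omega> * measure (P (X n \<omega>)) B \<partial>\<Omega>)"
    proof (rule integral_cong_AE)
      have "AE \<omega> in \<Omega>. real_cond_exp \<Omega> ?H (indicator I) \<omega> = measure (P (X n \<omega>)) B"
        using chain n B unfolding markov_chain_def I_def by blast
      thus "AE \<omega> in \<Omega>. Z \<omega> * real_cond_exp \<Omega> ?H (indicator I) \<omega> = Z \<omega> * measure (P (X n \<omega>)) B"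
        by eventually_elim simp
      show "(\<lambda>\<omega>. Z \<omega> * measure (P (X n \<omega>)) B) \<in> borel_measurable \<Omega>"
        by (intro bdd_measurable_measurable bdd_measurable_mult Zb pm)
    qed simp
    also have "ennreal \<dots> = (\<integral>\<^sup>+\<omega>. ennreal (Z \<omega> * measure (P (X n \<omega>)) B) \<partial>\<Omega>)"
      using Z0 by (intro nn_integral_eq_integral[symmetric] \<Omega>.integrable_bdd_measurable
          bdd_measurable_mult Zb pm AE_I2) auto
    also have "\<dots> = (\<integral>\<^sup>+\<omega>. ennreal (Z \<omega>) * emeasure (P (X n \<omega>)) B \<partial>\<Omega>)"
    proof (intro nn_integral_cong)
      fix \<omega> assume \<omega>: "\<omega> \<in> space \<Omega>"
      interpret prob_space "P (X n \<omega>)" by (rule kernelD(1)[OF spX(1)[OF \<omega>]])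
      show "ennreal (Z \<omega> * measure (P (X n \<omega>)) B) = ennreal (Z \<omega>) * emeasure (P (X n \<omega>)) B"
        using Z0[OF \<omega>] by (simp add: emeasure_eq_measure ennreal_mult)
    qed
    also have "\<dots> = emeasure (distr N M (X n) \<bind> P) B"
      using ne by (subst emeasure_bind[where N=M]) (simp_all add: nn_integral_distr N_def nn_integral_density)
    finally show "emeasure (distr N M (X (Suc n))) B = emeasure (distr N M (X n) \<bind> P) B" .
  qed
  hence "(\<integral>\<^sup>+x. ennreal (h x) \<partial>distr N M (X (Suc n))) = (\<integral>\<^sup>+x. ennreal (h x) \<partial>(distr N M (X n) \<bind> P))"
    by simp
  also have "\<dots> = (\<integral>\<^sup>+x. \<integral>\<^sup>+y. ennreal (h y) \<partial>P x \<partial>distr N M (X n))"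
    by (intro nn_integral_bind[where B=M]) auto
  also have "\<dots> = (\<integral>\<^sup>+x. ennreal (kernel_op P h x) \<partial>distr N M (X n))"
  proof (intro nn_integral_cong)
    fix x assume "x \<in> space (distr N M (X n))"
    hence x: "x \<in> space M" by simp
    show "(\<integral>\<^sup>+y. ennreal (h y) \<partial>P x) = ennreal (kernel_op P h x)"
      unfolding kernel_op_def
      using integrable_kernel[OF h x] h0 sets_eq_imp_space_eq[OF kernelD(2)[OF x]]
      by (intro nn_integral_eq_integral AE_I2) auto
  qed
  finally have "(\<integral>\<^sup>+x. ennreal (h x) \<partial>distr N M (X (Suc n)))
      = (\<integral>\<^sup>+x. ennreal (kernel_op P h x) \<partial>distr N M (X n))" .
  moreover have "(\<integral>\<^sup>+x. ennreal (k x) \<partial>distr N M Y) = (\<integral>\<^sup>+\<omega>. ennreal (Z \<omega> * k (Y \<omega>)) \<partial>\<Omega>)"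
    if [measurable]: "k \<in> borel_measurable M" "Y \<in> \<Omega> \<rightarrow>\<^sub>M M" for k Y
  proof -
    have "(\<integral>\<^sup>+x. ennreal (k x) \<partial>distr N M Y) = (\<integral>\<^sup>+\<omega>. ennreal (k (Y \<omega>)) \<partial>N)"
      by (subst nn_integral_distr) (auto simp: N_def)
    also have "\<dots> = (\<integral>\<^sup>+\<omega>. ennreal (Z \<omega>) * ennreal (k (Y \<omega>)) \<partial>\<Omega>)"
      unfolding N_def by (subst nn_integral_density) auto
    also have "\<dots> = (\<integral>\<^sup>+\<omega>. ennreal (Z \<omega> * k (Y \<omega>)) \<partial>\<Omega>)"
      by (intro nn_integral_cong) (simp add: Z0 ennreal_mult')
    finally show ?thesis .
  qed
  ultimately have nn: "(\<integral>\<^sup>+\<omega>. ennreal (Z \<omega> * h (X (Suc n) \<omega>)) \<partial>\<Omega>)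
      = (\<integral>\<^sup>+\<omega>. ennreal (Z \<omega> * kernel_op P h (X n \<omega>)) \<partial>\<Omega>)"
    using bdd_measurable_measurable[OF kernel_op_bdd_measurable[OF h]] by simp
  have Ph0: "0 \<le> kernel_op P h x" if "x \<in> space M" for x
    unfolding kernel_op_def using h0 that sets_eq_imp_space_eq[OF kernelD(2)[OF that]]
    by (intro integral_nonneg_AE AE_I2) auto
  note [measurable] = bdd_measurable_measurable[OF kernel_op_bdd_measurable[OF h]]
  show ?thesis
    using nn Z0 spX h0 Ph0 by (subst (1 2) integral_eq_nn_integral) auto
qed

text \<open>Conditioning on the history before the last time replaces the last factor
  \<open>F * h\<close> by \<open>tilted_op P F h\<close> one step earlier, so the induction needs
  \<open>h\<close> arbitrary. The exponent counts transitions, hence \<open>Suc n\<close> factors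
  for \<open>n\<close> applications of the operator.\<close>

lemma (in reversible_chain) expectation_prod_eq_tilted:
  assumes \<Omega>: "prob_space \<Omega>" and chain: "markov_chain \<Omega> M P X" and init: "distr \<Omega> M (X 1) = \<pi>"
    and F: "F \<in> bdd_measurable M" and F0: "\<And>x. x \<in> space M \<Longrightarrow> 0 \<le> F x"
    and h: "h \<in> bdd_measurable M" and h0: "\<And>x. x \<in> space M \<Longrightarrow> 0 \<le> h x"
  shows "(\<integral>\<omega>. (\<Prod>i=1..Suc n. F (X i \<omega>)) * h (X (Suc n) \<omega>) \<partial>\<Omega>)
    = (\<integral>x. F x * (tilted_op P F ^^ n) h x \<partial>\<pi>)"
  using h h0
proof (induction n arbitrary: h)
  case 0
  have "X 1 \<in> \<Omega> \<rightarrow>\<^sub>M M" using chain by (auto simp: markov_chain_def)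
  hence "(\<integral>x. F x * h x \<partial>\<pi>) = (\<integral>\<omega>. F (X 1 \<omega>) * h (X 1 \<omega>) \<partial>\<Omega>)"
    using bdd_measurable_measurable[OF bdd_measurable_mult[OF F 0(1)]]
    unfolding init[symmetric] by (intro integral_distr) auto
  thus ?case by simp
next
  case (Suc n)
  let ?Z = "\<lambda>\<omega>. \<Prod>i=1..Suc n. F (X i \<omega>)"
  have X: "X i \<omega> \<in> space M" if "\<omega> \<in> space \<Omega>" "1 \<le> i" for i \<omega>
    using that chain by (auto simp: markov_chain_def dest: measurable_space)
  have FX: "(\<lambda>\<omega>. F (X i \<omega>)) \<in> bdd_measurable (history \<Omega> M X (Suc n))" if "i \<in> {1..Suc n}" for i
    using F measurable_history[OF chain that] by (auto simp: bdd_measurable_def dest: measurable_space)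
  have "(\<lambda>\<omega>. \<Prod>i\<in>I. F (X i \<omega>)) \<in> bdd_measurable (history \<Omega> M X (Suc n))"
    if "I \<subseteq> {1..Suc n}" for I
    using finite_subset[OF that] that
    by induction (auto intro!: bdd_measurable_const bdd_measurable_mult FX)
  hence Z: "?Z \<in> bdd_measurable (history \<Omega> M X (Suc n))" by blast
  have Z0: "0 \<le> ?Z \<omega>" if "\<omega> \<in> space \<Omega>" for \<omega>
    using F0 X[OF that] by (intro prod_nonneg) auto
  have "(\<integral>\<omega>. (\<Prod>i=1..Suc (Suc n). F (X i \<omega>)) * h (X (Suc (Suc n)) \<omega>) \<partial>\<Omega>)
      = (\<integral>\<omega>. ?Z \<omega> * (F (X (Suc (Suc n)) \<omega>) * h (X (Suc (Suc n)) \<omega>)) \<partial>\<Omega>)"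
    by (simp add: ac_simps)
  also have "\<dots> = (\<integral>\<omega>. ?Z \<omega> * tilted_op P F h (X (Suc n) \<omega>) \<partial>\<Omega>)"
    unfolding tilted_op_def
    using F0 Suc.prems(2)
    by (intro markov_property[OF \<Omega> chain _ Z Z0] bdd_measurable_mult F Suc.prems(1)) auto
  also have "\<dots> = (\<integral>x. F x * (tilted_op P F ^^ n) (tilted_op P F h) x \<partial>\<pi>)"
    by (intro Suc.IH tilted_op_bdd_measurable tilted_op_nonneg F F0 Suc.prems)
  finally show ?case by (simp add: funpow_swap1)
qed

section \<open>Moment generating function and tail bound\<close>

lemma lambda_r_plus_range:
  assumes "lambda_r P \<pi> < 1" shows "0 \<le> lambda_r_plus P \<pi>" "lambda_r_plus P \<pi> < 1"
  using assms unfolding lambda_r_plus_def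
  by (cases "lambda_r P \<pi>"; auto simp: max_def zero_ereal_def one_ereal_def)+

context reversible_chain
begin

lemma tilted_form_le_exp_g:
  fixes f :: "'a \<Rightarrow> real" and c t lam \<sigma>2 :: real
  assumes gap: "lambda_r P \<pi> < 1" and lam: "lam = lambda_r_plus P \<pi>" and c: "0 < c"
    and fm: "f \<in> borel_measurable M" and bound: "\<forall>x\<in>space M. \<bar>f x\<bar> \<le> c"
    and mean: "(\<integral>x. f x \<partial>\<pi>) = 0" and var: "\<sigma>2 = (\<integral>x. (f x)\<^sup>2 \<partial>\<pi>)"
    and t: "0 \<le> t" "lam = 0 \<or> t < (1 - lam) / (5 * c)"
  shows "(\<integral>x. exp (t * f x) \<partial>\<pi>) \<le> exp (g t lam c \<sigma>2)"
    and "u \<in> bdd_measurable M \<Longrightarrow>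
      (\<integral>x. exp (t * f x) * u x * tilted_op P (\<lambda>y. exp (t * f y)) u x \<partial>\<pi>)
        \<le> exp (g t lam c \<sigma>2) * (\<integral>x. exp (t * f x) * (u x)\<^sup>2 \<partial>\<pi>)"
proof -
  define r where "r = exp (g t lam c \<sigma>2)"
  \<comment> \<open>\<open>K\<close> is the Bennett coefficient of \<open>(f x)^2\<close> and
    \<open>A\<close> the correction caused by correlation; together they satisfy
    \<open>g = \<sigma>2 * (K + A)\<close>.\<close>
  define K where "K = (exp (t * c) - 1 - t * c) / c\<^sup>2"
  define A where "A = lam * t\<^sup>2 / (1 - lam - 5 * (t * c))"
  define F where "F = (\<lambda>x. exp (t * f x))"
  have lam01: "0 \<le> lam" "lam < 1" using lambda_r_plus_range[OF gap] by (auto simp: lam)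
  have b: "lam = 0 \<or> 5 * (t * c) < 1 - lam" using t(2) c by (auto simp: field_simps)
  have fc: "\<bar>f x\<bar> \<le> c" if "x \<in> space M" for x using bound that by blast
  have f [intro!]: "f \<in> bdd_measurable M" by (rule bdd_measurableI[OF fm fc])
  have tf: "\<bar>t * f x\<bar> \<le> t * c" if "x \<in> space M" for x
    using fc[OF that] t(1) by (simp add: abs_mult mult_left_mono)
  have F [intro!]: "F \<in> bdd_measurable M" unfolding F_def
    using tf fm by (intro bdd_measurableI[where B="exp (t * c)"]) (auto simp: abs_le_iff)
  have E [intro!]: "(\<lambda>x. exp (- (t * f x))) \<in> bdd_measurable M"
    using tf fm by (intro bdd_measurableI[where B="exp (t * c)"]) (auto simp: abs_le_iff)
  note [intro!] = bdd_measurable_intros integrable_pi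
  have quadratic: "(\<integral>x. p + (q * f x + s * (f x)\<^sup>2) \<partial>\<pi>) = p + (q * (\<integral>x. f x \<partial>\<pi>) + s * \<sigma>2)" for p q s
    by (simp add: integrable_pi bdd_measurable_intros f prob_space var)
  have g_eq: "g t lam c \<sigma>2 = \<sigma>2 * (K + A)"
    by (simp add: g_def K_def A_def distrib_left ac_simps)
  have "0 \<le> exp (t * c) - 1 - t * c" using exp_ge_add_one_self[of "t * c"] by linarith
  hence K0: "0 \<le> K" unfolding K_def by (rule divide_nonneg_nonneg) simp
  have A0: "0 \<le> A" using lam01 b by (auto simp: A_def)
  have var0: "0 \<le> \<sigma>2" unfolding var by simp
  have r1: "1 + \<sigma>2 * (K + A) \<le> r" unfolding r_def g_eq by (rule exp_ge_add_one_self)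
  have r: "1 \<le> r" using r1 mult_nonneg_nonneg[OF var0 add_nonneg_nonneg[OF K0 A0]] by linarith
  have rl: "0 < r - lam" using r lam01 by simp
  have bennett: "F x \<le> 1 + t * f x + (f x)\<^sup>2 * K" if x: "x \<in> space M" for x
  proof -
    have "exp (f x / c * (t * c)) \<le> 1 + f x / c * (t * c) + (f x / c)\<^sup>2 * (exp (t * c) - 1 - t * c)"
      using fc[OF x] c t(1) by (intro exp_mult_quadratic_bound) auto
    thus ?thesis using c by (simp add: F_def K_def power_divide mult.commute)
  qed
  have "(\<integral>x. F x \<partial>\<pi>) \<le> (\<integral>x. 1 + (t * f x + K * (f x)\<^sup>2) \<partial>\<pi>)"
    using bennett by (intro integral_mono integrable_pi bdd_measurable_intros F f)
      (auto simp: space_pi algebra_simps)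
  also have "\<dots> = 1 + (t * (\<integral>x. f x \<partial>\<pi>) + K * \<sigma>2)"
    by (rule quadratic)
  also have "\<dots> \<le> r" using r1 mult_nonneg_nonneg[OF var0 A0] by (simp add: mean algebra_simps)
  finally show "(\<integral>x. exp (t * f x) \<partial>\<pi>) \<le> exp (g t lam c \<sigma>2)" by (simp add: F_def r_def)

  \<comment> \<open>\<open>W\<close> is \<open>r / F - lam\<close>, and \<open>G\<close> is the
    quadratic majorant of \<open>(1 - lam) / W\<close>. Its linear coefficient contains the tangent
    slope \<open>a\<close>, and the linear term integrates to 0 because \<open>f\<close> has mean
    0.\<close>
  define W where "W = (\<lambda>x. r * exp (- (t * f x)) - lam)"
  define a where "a = 1 - lam * (r - 1) / (r - lam)"
  define G where "G = (\<lambda>x. (1 + (1 - r) / (r - lam))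
      + (a * t / (r - lam) * f x + (K + A) / (r - lam) * (f x)\<^sup>2))"
  have W [intro!]: "W \<in> bdd_measurable M" unfolding W_def by (intro bdd_measurable_intros E)
  have G [intro!]: "G \<in> bdd_measurable M" unfolding G_def by (intro bdd_measurable_intros f)
  have W0: "0 < W x" and WG: "(1 - lam) / W x \<le> G x" if x: "x \<in> space M" for x
  proof -
    note B = resolvent_quadratic_bound[OF lam01 tf[OF x] b r bennett[OF x, unfolded F_def]]
    show "0 < W x" using B(1) by (simp add: W_def)
    have "lam * (t * f x)\<^sup>2 / (1 - lam - 5 * (t * c)) = A * (f x)\<^sup>2"
      by (simp add: A_def power_mult_distrib)
    moreover have "G x = 1 + (1 - r + a * (t * f x) + ((f x)\<^sup>2 * K + A * (f x)\<^sup>2)) / (r - lam)"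
      unfolding G_def by (simp add: add_divide_distrib diff_divide_distrib algebra_simps)
    ultimately show "(1 - lam) / W x \<le> G x" using B(2) by (simp add: W_def flip: a_def)
  qed
  have "(\<integral>x. G x \<partial>\<pi>) = (1 + (1 - r) / (r - lam))
      + (a * t / (r - lam) * (\<integral>x. f x \<partial>\<pi>) + (K + A) / (r - lam) * \<sigma>2)"
    unfolding G_def by (rule quadratic)
  also have "\<dots> = 1 + (1 - r + \<sigma>2 * (K + A)) / (r - lam)"
    by (simp add: mean add_divide_distrib diff_divide_distrib algebra_simps)
  \<comment> \<open>This is where the choice of \<open>r\<close> enters:
    \<open>exp g \<ge> 1 + g\<close> makes the numerator nonpositive.\<close>
  also have "\<dots> \<le> 1" using r1 rl by (simp add: divide_nonpos_pos)
  finally have G1: "(\<integral>x. G x \<partial>\<pi>) \<le> 1" .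

  assume u [intro!]: "u \<in> bdd_measurable M"
  define v where "v = (\<lambda>x. F x * u x)"
  have v [intro!]: "v \<in> bdd_measurable M" unfolding v_def by (intro bdd_measurable_intros F u)
  have "(\<integral>x. F x * u x * tilted_op P F u x \<partial>\<pi>) = (\<integral>x. v x * kernel_op P v x \<partial>\<pi>)"
    by (simp add: v_def tilted_op_def)
  also have "\<dots> \<le> (1 - lam) * (\<integral>x. v x \<partial>\<pi>)\<^sup>2 + lam * (\<integral>x. (v x)\<^sup>2 \<partial>\<pi>)"
    unfolding lam by (rule dirichlet_form_bound[OF gap v])
  also have "(1 - lam) * (\<integral>x. v x \<partial>\<pi>)\<^sup>2 \<le> (\<integral>x. (v x)\<^sup>2 * W x \<partial>\<pi>)"
    using W0 WG G1 lam01
    by (intro square_expectation_le_weighted[where G=G]) (auto simp: bdd_measurable_pi space_pi)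
  \<comment> \<open>Adding back the \<open>lam\<close> term turns the weight \<open>W\<close> into
    \<open>r / F\<close>, and \<open>v^2 / F = F * u^2\<close>.\<close>
  also have "(\<integral>x. (v x)\<^sup>2 * W x \<partial>\<pi>) + lam * (\<integral>x. (v x)\<^sup>2 \<partial>\<pi>)
      = (\<integral>x. (v x)\<^sup>2 * W x + lam * (v x)\<^sup>2 \<partial>\<pi>)"
    by (subst Bochner_Integration.integral_add) auto
  also have "\<dots> = (\<integral>x. r * (F x * (u x)\<^sup>2) \<partial>\<pi>)"
  proof (intro Bochner_Integration.integral_cong refl)
    fix x
    have "F x * exp (- (t * f x)) = 1" by (simp add: F_def flip: exp_add)
    hence "F x * (u x)\<^sup>2 = (F x * exp (- (t * f x))) * (F x * (u x)\<^sup>2)" by simp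
    also have "\<dots> = (v x)\<^sup>2 * exp (- (t * f x))" by (simp add: v_def power2_eq_square ac_simps)
    finally show "(v x)\<^sup>2 * W x + lam * (v x)\<^sup>2 = r * (F x * (u x)\<^sup>2)"
      by (simp add: W_def algebra_simps)
  qed
  finally show "(\<integral>x. exp (t * f x) * u x * tilted_op P (\<lambda>y. exp (t * f y)) u x \<partial>\<pi>)
        \<le> exp (g t lam c \<sigma>2) * (\<integral>x. exp (t * f x) * (u x)\<^sup>2 \<partial>\<pi>)"
    by (simp add: F_def r_def)
qed

text \<open>A path of \<open>n\<close> points has \<open>n - 1\<close> transitions, each costing a
  factor \<open>exp g\<close>; the remaining factor comes from the mean of
  \<open>exp (t * f)\<close> under the initial law.\<close>

lemma mgf_bound:
  fixes f :: "'a \<Rightarrow> real" and c t lam \<sigma>2 :: real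
  assumes \<Omega>: "prob_space \<Omega>" and chain: "markov_chain \<Omega> M P X" and init: "distr \<Omega> M (X 1) = \<pi>"
    and gap: "lambda_r P \<pi> < 1" and lam: "lam = lambda_r_plus P \<pi>" and c: "0 < c"
    and fm: "f \<in> borel_measurable M" and bound: "\<forall>x\<in>space M. \<bar>f x\<bar> \<le> c"
    and mean: "(\<integral>x. f x \<partial>\<pi>) = 0" and var: "\<sigma>2 = (\<integral>x. (f x)\<^sup>2 \<partial>\<pi>)"
    and t: "0 \<le> t" "lam = 0 \<or> t < (1 - lam) / (5 * c)"
    and n: "1 \<le> n"
  shows "(\<integral>\<omega>. exp (t * (\<Sum>i=1..n. f (X i \<omega>))) \<partial>\<Omega>) \<le> exp (real n * g t lam c \<sigma>2)"
proof -
  obtain m where m: "n = Suc m" using n by (cases n) auto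
  define F where "F = (\<lambda>x. exp (t * f x))"
  let ?r = "exp (g t lam c \<sigma>2)"
  have form: "(\<integral>x. F x \<partial>\<pi>) \<le> ?r"
    and form': "\<And>u. u \<in> bdd_measurable M \<Longrightarrow>
      (\<integral>x. F x * u x * tilted_op P F u x \<partial>\<pi>) \<le> ?r * (\<integral>x. F x * (u x)\<^sup>2 \<partial>\<pi>)"
    unfolding F_def by (rule tilted_form_le_exp_g[OF gap lam c fm bound mean var t]; assumption)+
  have F0: "0 \<le> F x" for x by (simp add: F_def)
  have F: "F \<in> bdd_measurable M" unfolding F_def
    using bound fm t(1) by (intro bdd_measurableI[where B="exp (t * c)"])
      (auto simp: abs_le_iff intro!: mult_left_mono)
  have "(\<integral>\<omega>. exp (t * (\<Sum>i=1..n. f (X i \<omega>))) \<partial>\<Omega>)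
      = (\<integral>\<omega>. (\<Prod>i=1..Suc m. F (X i \<omega>)) * 1 \<partial>\<Omega>)"
    unfolding m F_def by (simp only: sum_distrib_left exp_sum finite_atLeastAtMost mult_1_right)
  also have "\<dots> = (\<integral>x. F x * (tilted_op P F ^^ m) (\<lambda>_. 1) x \<partial>\<pi>)"
    by (rule expectation_prod_eq_tilted[OF \<Omega> chain init F F0 bdd_measurable_const]) simp
  also have "\<dots> \<le> ?r ^ m * (\<integral>x. F x \<partial>\<pi>)"
    by (rule tilted_op_pow_bound[OF F F0 form']) auto
  also have "\<dots> \<le> ?r ^ m * ?r" using form by (intro mult_left_mono) auto
  also have "\<dots> = exp (real n * g t lam c \<sigma>2)"
    unfolding m exp_of_nat_mult by simp
  finally show ?thesis .
qed

end

section \<open>Exponential Markov inequality and optimization over the parameter\<close>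

lemma (in prob_space) chernoff_bound:
  fixes S :: "'a \<Rightarrow> real"
  assumes S: "S \<in> bdd_measurable M" and t: "0 \<le> t"
    and mgf: "expectation (\<lambda>\<omega>. exp (t * S \<omega>)) \<le> exp k"
  shows "prob {\<omega> \<in> space M. s \<le> S \<omega>} \<le> exp (k - t * s)"
proof -
  have [measurable]: "S \<in> borel_measurable M" by (rule bdd_measurable_measurable[OF S])
  obtain B where B: "\<And>\<omega>. \<omega> \<in> space M \<Longrightarrow> \<bar>S \<omega>\<bar> \<le> B"
    using S by (auto simp: bdd_measurable_def)
  have int: "integrable M (\<lambda>\<omega>. exp (t * S \<omega>))"
    using B t by (intro integrable_const_bound[where B="exp (t * B)"] AE_I2)
      (auto simp: abs_le_iff intro!: mult_left_mono)
  have "{\<omega> \<in> space M. s \<le> S \<omega>} \<subseteq> {\<omega> \<in> space M. exp (t * s) \<le> exp (t * S \<omega>)}"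
    using t by (auto intro: mult_left_mono)
  hence "prob {\<omega> \<in> space M. s \<le> S \<omega>} \<le> prob {\<omega> \<in> space M. exp (t * s) \<le> exp (t * S \<omega>)}"
    by (intro finite_measure_mono) auto
  also have "\<dots> \<le> expectation (\<lambda>\<omega>. exp (t * S \<omega>)) / exp (t * s)"
    using int by (intro integral_Markov_inequality_measure[where A="{}"]) auto
  also have "\<dots> \<le> exp k / exp (t * s)" using mgf by (intro divide_right_mono) auto
  finally show ?thesis by (simp add: exp_diff)
qed

text \<open>The supremum need not be attained and may be infinite. For \<open>p > 0\<close>, taking
  logarithms makes \<open>- ln p / m\<close> an upper bound of all values, hence of the supremum;
  for \<open>p = 0\<close> nonnegativity of \<open>exp_ereal\<close> suffices.\<close>

lemma le_exp_ereal_neg_SUP: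
  fixes p m :: real and \<phi> :: "real \<Rightarrow> real"
  assumes m: "0 < m" and p: "0 \<le> p" and ne: "T \<noteq> {}"
    and bound: "\<And>t. t \<in> T \<Longrightarrow> p \<le> exp (- (m * \<phi> t))"
  shows "ereal p \<le> exp_ereal (- (ereal m * (SUP t\<in>T. ereal (\<phi> t))))"
proof (cases "p = 0")
  case True
  have "0 \<le> exp_ereal x" for x by (cases x) (auto simp: exp_ereal_def)
  thus ?thesis using True by (simp add: zero_ereal_def)
next
  case False
  hence p0: "0 < p" using p by simp
  let ?s = "SUP t\<in>T. ereal (\<phi> t)"
  have "\<phi> t \<le> - ln p / m" if "t \<in> T" for t
  proof -
    have "ln p \<le> - (m * \<phi> t)" using bound[OF that] p0 ln_le_cancel_iff[of p "exp (- (m * \<phi> t))"] by simp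
    thus ?thesis using m by (simp add: field_simps)
  qed
  hence up: "?s \<le> ereal (- ln p / m)" by (intro SUP_least) auto
  obtain t where "t \<in> T" using ne by auto
  hence "ereal (\<phi> t) \<le> ?s" by (intro SUP_upper)
  \<comment> \<open>A member of \<open>T\<close> excludes -\<infinity> and the upper bound excludes
    \<infinity>.\<close>
  with up obtain s where s: "?s = ereal s" by (cases ?s) auto
  hence "m * s \<le> - ln p" using up m by (simp add: field_simps)
  hence "p \<le> exp (- (m * s))" using p0 by (metis exp_le_cancel_iff exp_ln le_minus_iff)
  thus ?thesis by (simp add: s exp_ereal_def)
qed

theorem theorem2:
  fixes M \<pi> :: "'a measure" and P :: "'a \<Rightarrow> 'a measure"
    and \<Omega> :: "'w measure" and X :: "nat \<Rightarrow> 'w \<Rightarrow> 'a"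
    and f :: "'a \<Rightarrow> real" and c lam \<sigma>2 :: real
  assumes "standard_borel M"
    and "P \<in> M \<rightarrow>\<^sub>M prob_algebra M"
    and "prob_space \<pi>" and "sets \<pi> = sets M"
    and "invariant_measure P \<pi>"
    and "reversible_kernel P \<pi>"
    and "lambda_r P \<pi> < 1"
    and "prob_space \<Omega>"
    and "markov_chain \<Omega> M P X"
    and "distr \<Omega> M (X 1) = \<pi>"
    and "c > 0"
    and "f \<in> borel_measurable M"
    and "\<forall>x \<in> space M. \<bar>f x\<bar> \<le> c"
    and "(\<integral> x. f x \<partial>\<pi>) = 0"
    and "\<sigma>2 = (\<integral> x. (f x)\<^sup>2 \<partial>\<pi>)"
    and "lam = lambda_r_plus P \<pi>"
  shows "(\<forall>n::nat. n \<ge> 1 \<longrightarrow> (\<forall>t. 0 \<le> t \<and> t < (1 - lam) / (5 * c) \<longrightarrow>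
            (\<integral> \<omega>. exp (t * (\<Sum>i=1..n. f (X i \<omega>))) \<partial>\<Omega>) \<le> exp (real n * g t lam c \<sigma>2)))
       \<and> (\<forall>n::nat. n \<ge> 1 \<longrightarrow> (\<forall>\<epsilon>>0.
            ereal (measure \<Omega> {\<omega> \<in> space \<Omega>. 1 / real n * (\<Sum>i=1..n. f (X i \<omega>)) \<ge> \<epsilon>})
              \<le> exp_ereal (- (ereal (real n) * g_conj \<epsilon> lam c \<sigma>2))))"
proof -
  interpret \<pi>: prob_space \<pi> by (rule assms)
  interpret reversible_chain \<pi> M P
    by unfold_locales (use assms in auto)
  interpret \<Omega>: prob_space \<Omega> by (rule assms)
  note mgf = mgf_bound[OF assms(8,9,10,7,16,11-15)]
  have X: "X i \<in> \<Omega> \<rightarrow>\<^sub>M M" if "1 \<le> i" for i using assms(9) that by (auto simp: markov_chain_def)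
  have lam: "0 \<le> lam" "lam < 1" using lambda_r_plus_range[OF assms(7)] by (auto simp: assms(16))
  have tail: "ereal (measure \<Omega> {\<omega> \<in> space \<Omega>. 1 / real n * (\<Sum>i=1..n. f (X i \<omega>)) \<ge> \<epsilon>})
      \<le> exp_ereal (- (ereal (real n) * g_conj \<epsilon> lam c \<sigma>2))" if n: "1 \<le> n" for n :: nat and \<epsilon> :: real
    unfolding g_conj_def
  proof (rule le_exp_ereal_neg_SUP)
    define S where "S = (\<lambda>\<omega>. \<Sum>i=1..n. f (X i \<omega>))"
    have "S \<in> borel_measurable \<Omega>"
      unfolding S_def using X assms(12) by (intro borel_measurable_sum measurable_compose[OF X]) auto
    moreover have "\<bar>S \<omega>\<bar> \<le> (\<Sum>i=1..n. c)" if "\<omega> \<in> space \<Omega>" for \<omega>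
      unfolding S_def using measurable_space[OF X that]
      by (intro order_trans[OF sum_abs] sum_mono) (use assms(13) in auto)
    ultimately have S: "S \<in> bdd_measurable \<Omega>" by (rule bdd_measurableI)
    \<comment> \<open>For \<open>lam = 0\<close> the parameter ranges over the whole half-line,
      beyond the range in the first claim; \<open>mgf\<close> covers these values too.\<close>
    fix t assume "t \<in> (if lam = 0 then {0..} else {0..<(1 - lam) / (5 * c)})"
    hence t: "0 \<le> t" "lam = 0 \<or> t < (1 - lam) / (5 * c)" by (auto split: if_splits)
    have "\<Omega>.prob {\<omega> \<in> space \<Omega>. real n * \<epsilon> \<le> S \<omega>} \<le> exp (real n * g t lam c \<sigma>2 - t * (real n * \<epsilon>))"
      using mgf[OF t n] by (intro \<Omega>.chernoff_bound S t(1)) (simp add: S_def)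
    also have "real n * g t lam c \<sigma>2 - t * (real n * \<epsilon>) = - (real n * (t * \<epsilon> - g t lam c \<sigma>2))"
      by (simp add: algebra_simps)
    also have "{\<omega> \<in> space \<Omega>. real n * \<epsilon> \<le> S \<omega>}
        = {\<omega> \<in> space \<Omega>. 1 / real n * (\<Sum>i=1..n. f (X i \<omega>)) \<ge> \<epsilon>}"
      using n by (auto simp: S_def field_simps)
    finally show "\<Omega>.prob {\<omega> \<in> space \<Omega>. 1 / real n * (\<Sum>i=1..n. f (X i \<omega>)) \<ge> \<epsilon>}
        \<le> exp (- (real n * (t * \<epsilon> - g t lam c \<sigma>2)))" .
  \<comment> \<open>The witness \<open>t = 0\<close> lies in either parameter range, since
    \<open>lam < 1\<close> and \<open>c > 0\<close>.\<close>
  qed (use n lam assms(11) in \<open>auto intro!: exI[of _ 0]\<close>)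
  show ?thesis using mgf tail by blast
qed

end
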